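(* Let $(X,*,0)$ be a BCK-algebra and let $\|\cdot\|_f : X\times(0,\infty)\to[0,1]$ be a fuzzy BCK/BCI-norm on $X$. Then the following assertions hold for all $x,y,z\in X$ and all $s,t\in(0,\infty)$: (1) $\|(0,t)\|_f=1$; (2) $\|(x*0,t)\|_f=\|(x,t)\|_f$; (3) $\|(x*x,t)\|_f=1$; (4) if $x\neq 0$, then $\|(x,t)\|_f<1$; (5) if $x\le y$, then $\|(x,s+t)\|_f\ge\|(y,t)\|_f$; (6) $\|(x*z,s+t)\|_f\ge\|(x,s)\|_f$; (7) $\|(x,s+t)\|_f\ge\min\{\|(x*y,s)\|_f,\|(y,t)\|_f\}$; (8) if $\lim_{t\to0^+}\|(x,t)\|_f=1$, then $x=0$.
   Context: A BCI-algebra is a set $X$ with a binary operation $*$ and a distinguished element $0$ such that for all $a,b,c\in X$: (I1) $((a*b)*(a*c))*(c*b)=0$; (I2) $(a*(a*b))*b=0$; (I3) $a*a=0$; (I4) $a*b=0$ and $b*a=0$ imply $a=b$. A BCK-algebra is a BCI-algebra that also satisfies (K): $0*a=0$ for all $a\in X$. The order relation on $X$ is defined by $a\le b$ if and only if $a*b=0$. For a BCK-algebra or BCI-algebra $(X,*,0)$, a fuzzy BCK/BCI-norm on $X$ is a mapping $\|\cdot\|_f : X\times(0,\infty)\to[0,1]$, with values written $\|(x,t)\|_f$, satisfying for all $x,y,z\in X$ and $s,t\in(0,\infty)$: (FN1) $\|(x,t)\|_f=1$ if and only if $x=0$; (FN2) if $t\ge s$ then $\|(x,t)\|_f\ge\|(x,s)\|_f$;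 (FN3) $\lim_{t\to\infty}\|(x,t)\|_f=1$; (FN4) $\|(x*z,s+t)\|_f\ge\min\{\|(x*y,s)\|_f,\|(y*z,t)\|_f\}$. *)

theory Defs
  imports Complex_Main
begin

locale BCI_algebra =
  fixes X :: "'a set"
    and bop :: "'a \<Rightarrow> 'a \<Rightarrow> 'a"  (infixl "\<star>" 70)
    and zer :: "'a"  ("\<zero>")
  assumes closed: "\<lbrakk>a \<in> X; b \<in> X\<rbrakk> \<Longrightarrow> a \<star> b \<in> X"
    and zero_closed: "\<zero> \<in> X"
    and I1: "\<lbrakk>a \<in> X; b \<in> X; c \<in> X\<rbrakk> \<Longrightarrow> ((a \<star> b) \<star> (a \<star> c)) \<star> (c \<star> b) = \<zero>"
    and I2: "\<lbrakk>a \<in> X; b \<in> X\<rbrakk> \<Longrightarrow> (a \<star> (a \<star> b)) \<star> b = \<zero>"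
    and I3: "a \<in> X \<Longrightarrow> a \<star> a = \<zero>"
    and I4: "\<lbrakk>a \<in> X; b \<in> X; a \<star> b = \<zero>; b \<star> a = \<zero>\<rbrakk> \<Longrightarrow> a = b"

locale BCK_algebra = BCI_algebra +
  assumes K: "a \<in> X \<Longrightarrow> \<zero> \<star> a = \<zero>"

definition BCI_le :: "('a \<Rightarrow> 'a \<Rightarrow> 'a) \<Rightarrow> 'a \<Rightarrow> 'a \<Rightarrow> 'a \<Rightarrow> bool"
  where "BCI_le bop zer a b \<longleftrightarrow> bop a b = zer"

(* The norm is a map on X \<times> (0,\<infinity>); its values outside that domain are left
   unconstrained and irrelevant. The underlying algebra is only required to be BCI, which
   covers the BCK case. *)
locale fuzzy_BCK_BCI_norm = BCI_algebra +
  fixes N :: "'a \<times> real \<Rightarrow> real"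
  assumes range: "\<lbrakk>x \<in> X; 0 < t\<rbrakk> \<Longrightarrow> N (x, t) \<in> {0..1}"
    and FN1: "\<lbrakk>x \<in> X; 0 < t\<rbrakk> \<Longrightarrow> N (x, t) = 1 \<longleftrightarrow> x = \<zero>"
    and FN2: "\<lbrakk>x \<in> X; 0 < s; 0 < t; t \<ge> s\<rbrakk> \<Longrightarrow> N (x, t) \<ge> N (x, s)"
    and FN3: "x \<in> X \<Longrightarrow> ((\<lambda>t. N (x, t)) \<longlongrightarrow> 1) at_top"
    and FN4: "\<lbrakk>x \<in> X; y \<in> X; z \<in> X; 0 < s; 0 < t\<rbrakk>
      \<Longrightarrow> N (x \<star> z, s + t) \<ge> min (N (x \<star> y, s)) (N (y \<star> z, t))"

end

theory Submission
  imports Defs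
begin

text \<open>The triangle inequality \<open>FN4\<close> does most of the work once one of its points
  is \<open>\<zero>\<close>, because \<open>x \<star> \<zero> = x\<close>
  (\<open>right_zero\<close>) and \<open>\<zero> \<star> z = \<zero>\<close> (\<open>K\<close>)
  simplify its terms. A term at \<open>\<zero>\<close> has norm 1, the largest value, so it drops
  out of the minimum. The limit claim rests instead on monotonicity in \<open>t\<close>, followed by
  \<open>FN1\<close>.\<close>

lemma (in BCK_algebra) right_zero:
  assumes "x \<in> X"
  shows "x \<star> \<zero> = x"
proof (rule I4)
  \<comment> \<open>\<open>I2\<close> at the pair \<open>x\<close>, \<open>x\<close>; the inner
    \<open>x \<star> x\<close> collapses to \<open>\<zero>\<close>.\<close>
  have "(x \<star> (x \<star> x)) \<star> x = \<zero>"
    using assms by (intro I2)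
  then show "(x \<star> \<zero>) \<star> x = \<zero>"
    using assms by (simp add: I3)
  \<comment> \<open>\<open>x \<star> (x \<star> \<zero>)\<close> lies below \<open>\<zero>\<close>
    by \<open>I2\<close> and above it by \<open>K\<close>, so antisymmetry makes it
    \<open>\<zero>\<close>.\<close>
  have "(x \<star> (x \<star> \<zero>)) \<star> \<zero> = \<zero>"
    using assms zero_closed by (intro I2)
  moreover have "\<zero> \<star> (x \<star> (x \<star> \<zero>)) = \<zero>"
    using assms zero_closed by (intro K closed)
  ultimately show "x \<star> (x \<star> \<zero>) = \<zero>"
    using assms zero_closed closed I4[of "x \<star> (x \<star> \<zero>)" \<zero>] by simp
qed (use assms zero_closed in \<open>auto intro: closed\<close>)

lemma (in fuzzy_BCK_BCI_norm) norm_zero: "0 < t \<Longrightarrow> N (\<zero>, t) = 1"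
  using FN1 zero_closed by blast

lemma (in fuzzy_BCK_BCI_norm) norm_le_one: "x \<in> X \<Longrightarrow> 0 < t \<Longrightarrow> N (x, t) \<le> 1"
  using range by fastforce

text \<open>By \<open>FN2\<close> the norm is nondecreasing in time, so its limit at 0 from the
  right bounds every later value from below. One time suffices for \<open>FN1\<close>; the choice of
  1 is arbitrary.\<close>

lemma (in fuzzy_BCK_BCI_norm) eq_zero_if_tendsto_one_at_zero:
  assumes x: "x \<in> X" and lim: "((\<lambda>u. N (x, u)) \<longlongrightarrow> 1) (at_right 0)"
  shows "x = \<zero>"
proof -
  have "\<forall>\<^sub>F u in at_right (0::real). 0 < u \<and> u < 1"
    by (auto simp: eventually_at_right_field intro: exI[of _ 1])
  then have "\<forall>\<^sub>F u in at_right 0. N (x, u) \<le> N (x, 1)"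
    by eventually_elim (use x in \<open>auto intro: FN2\<close>)
  then have "1 \<le> N (x, 1)"
    by (intro tendsto_upperbound[OF lim]) simp_all
  then have "N (x, 1) = 1"
    using norm_le_one[OF x, of 1] by simp
  then show ?thesis
    using FN1[OF x, of 1] by simp
qed

theorem proposition3p4:
  fixes X :: "'a set"
    and bop :: "'a \<Rightarrow> 'a \<Rightarrow> 'a"  (infixl "\<star>" 70)
    and zer :: "'a"  ("\<zero>")
    and N :: "'a \<times> real \<Rightarrow> real"
  assumes "BCK_algebra X (\<star>) \<zero>"
    and "fuzzy_BCK_BCI_norm X (\<star>) \<zero> N"
  shows "\<forall>x\<in>X. \<forall>y\<in>X. \<forall>z\<in>X. \<forall>s>0. \<forall>t>0.
      N (\<zero>, t) = 1
    \<and> N (x \<star> \<zero>, t) = N (x, t)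
    \<and> N (x \<star> x, t) = 1
    \<and> (x \<noteq> \<zero> \<longrightarrow> N (x, t) < 1)
    \<and> (BCI_le (\<star>) \<zero> x y \<longrightarrow> N (x, s + t) \<ge> N (y, t))
    \<and> N (x \<star> z, s + t) \<ge> N (x, s)
    \<and> N (x, s + t) \<ge> min (N (x \<star> y, s)) (N (y, t))
    \<and> (((\<lambda>u. N (x, u)) \<longlongrightarrow> 1) (at_right 0) \<longrightarrow> x = \<zero>)"
proof -
  interpret BCK_algebra X "(\<star>)" \<zero> by fact
  interpret fuzzy_BCK_BCI_norm X "(\<star>)" \<zero> N by fact
  show ?thesis
  proof (intro ballI allI impI conjI)
    fix x y z and s t :: real
    assume x: "x \<in> X" and y: "y \<in> X" and z: "z \<in> X" and s: "0 < s" and t: "0 < t"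
    note le_one = norm_le_one[OF x s] norm_le_one[OF y t]
    show "N (\<zero>, t) = 1"
      using t by (rule norm_zero)
    show "N (x \<star> \<zero>, t) = N (x, t)"
      using x by (simp add: right_zero)
    show "N (x \<star> x, t) = 1"
      using x t by (simp add: I3 norm_zero)
    show "N (x, t) < 1" if "x \<noteq> \<zero>"
      using that FN1[OF x t] norm_le_one[OF x t] by simp
    \<comment> \<open>\<open>FN4\<close> with last point \<open>\<zero>\<close>.\<close>
    show triangle: "N (x, s + t) \<ge> min (N (x \<star> y, s)) (N (y, t))"
      using FN4[OF x y zero_closed s t] x y by (simp add: right_zero)
    \<comment> \<open>Here \<open>x \<star> y = \<zero>\<close>, so the first entry of the minimum
      in \<open>triangle\<close> is 1.\<close>
    show "N (x, s + t) \<ge> N (y, t)" if "BCI_le (\<star>) \<zero> x y"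
      using that triangle le_one s by (simp add: BCI_le_def norm_zero)
    \<comment> \<open>\<open>FN4\<close> with middle point \<open>\<zero>\<close>: by
      \<open>K\<close> the second entry is \<open>N (\<zero>, t) = 1\<close>.\<close>
    show "N (x \<star> z, s + t) \<ge> N (x, s)"
      using FN4[OF x zero_closed z s t] x z t le_one by (simp add: right_zero K norm_zero)
    show "x = \<zero>" if "((\<lambda>u. N (x, u)) \<longlongrightarrow> 1) (at_right 0)"
      using x that by (rule eq_zero_if_tendsto_one_at_zero)
  qed
qed

end
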